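(* Let $d\ge2$ be even, $n\ge1$ and $\mathcal A\in\mathbb S^{n^d}$. There exist $\mathcal X^*\in C$, $\mathcal Y^*\in\mathbb S^{n^d}$ and $\Lambda^*\in\mathbb R^{n^d}$ satisfying $$\langle-\Lambda^*,\mathcal X-\mathcal X^*\rangle\ge 0\ \ \forall \mathcal X\in C,\qquad \langle-\mathcal A+\Lambda^*,\mathcal Y-\mathcal Y^*\rangle\ge 0\ \ \forall\mathcal Y\in\mathbb S^{n^d},\qquad \mathcal X^*=\mathcal Y^*$$ if and only if the SDP relaxation (R) is tight.
   Context: All tensors are real. $\mathbb R^{n^d}$ is the space of $d$-th order $n$-dimensional tensors with entrywise inner product $\langle\cdot,\cdot\rangle$; $\mathbb S^{n^d}$ is the subspace of symmetric tensors (entries invariant under all permutations of the indices). For even $d$, $\mathrm{Mat}(\mathcal B)\in\mathbb R^{n^{d/2}\times n^{d/2}}$ is the reshaping of $\mathcal B$ with rows indexed by the first $d/2$ indices and columns by the last $d/2$ indices (enumerated in the same way). $C=\{\mathcal X\in\mathbb R^{n^d}\mid \operatorname{rank}(\mathrm{Mat}(\mathcal X))=1,\ \mathrm{Mat}(\mathcal X)\text{ symmetric},\ \operatorname{tr}(\mathrm{Mat}(\mathcal X))=1\}$. Problem (O) ($d$ even): maximize $\langle\mathcal A,\mathcal X\rangle$ subject to $\operatorname{rank}(\mathrm{Mat}(\mathcal X))=1$, $\mathcal X\in\mathbb S^{n^d}$, $\operatorname{tr}(\mathrm{Mat}(\mathcal X))=1$. SDP relaxation (R): maximize $\langle\mathcal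 A,\mathcal X\rangle$ subject to $\mathrm{Mat}(\mathcal X)\succeq0$, $\mathcal X\in\mathbb S^{n^d}$, $\operatorname{tr}(\mathrm{Mat}(\mathcal X))=1$. (R) is called tight if (R) and (O) have the same optimal value. *)

theory Defs
  imports "HOL-Analysis.Analysis"
begin

text \<open>
  Real tensors of even order \<open>d\<close> and dimension \<open>n\<close>, where \<open>n = CARD('n)\<close> and
  \<open>d = CARD('m + 'm) = 2 * CARD('m)\<close>.  A multi-index is a function from the \<open>d\<close> index positions
  to \<open>'n\<close>; the positions \<open>Inl _\<close> are the first \<open>d/2\<close> ones, the positions \<open>Inr _\<close> the last \<open>d/2\<close>.
  As types are nonempty, every even \<open>d \<ge> 2\<close> and every \<open>n \<ge> 1\<close> arises in this way, and nothing else.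
  The library inner product on this vector type is the entrywise one.
\<close>

type_synonym ('m, 'n) tensor = "real ^ ('m + 'm \<Rightarrow> 'n)"

definition sym_tensors :: "('m::finite, 'n::finite) tensor set" where
  "sym_tensors = {B. \<forall>p. p permutes UNIV \<longrightarrow> (\<forall>i. B $ (i \<circ> p) = B $ i)}"

text \<open>
  Row and column of \<open>Mat B\<close> are each a multi-index of length \<open>d/2\<close>; \<open>case_sum r c\<close> is their
  concatenation.
\<close>

definition Mat :: "('m::finite, 'n::finite) tensor \<Rightarrow> real ^ ('m \<Rightarrow> 'n) ^ ('m \<Rightarrow> 'n)" where
  "Mat B = (\<chi> r c. B $ case_sum r c)"

definition psd :: "real ^ 'k ^ 'k \<Rightarrow> bool" where
  "psd M \<longleftrightarrow> transpose M = M \<and> (\<forall>v. 0 \<le> v \<bullet> (M *v v))"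

definition C_set :: "('m::finite, 'n::finite) tensor set" where
  "C_set = {X. rank (Mat X) = 1 \<and> transpose (Mat X) = Mat X \<and> trace (Mat X) = 1}"

definition feasible_O :: "('m::finite, 'n::finite) tensor set" where
  "feasible_O = {X. rank (Mat X) = 1 \<and> X \<in> sym_tensors \<and> trace (Mat X) = 1}"

definition feasible_R :: "('m::finite, 'n::finite) tensor set" where
  "feasible_R = {X. psd (Mat X) \<and> X \<in> sym_tensors \<and> trace (Mat X) = 1}"

text \<open>Extended reals, so that the supremum is meaningful without boundedness or nonemptiness.\<close>

definition max_value :: "('m::finite, 'n::finite) tensor \<Rightarrow> ('m, 'n) tensor set \<Rightarrow> ereal" where
  "max_value A F = (SUP X\<in>F. ereal (A \<bullet> X))"

definition tight :: "('m::finite, 'n::finite) tensor \<Rightarrow> bool" where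
  "tight A \<longleftrightarrow> max_value A feasible_R = max_value A feasible_O"

end

theory Submission
  imports Defs
begin

text \<open>
  The equilibrium condition says that \<open>L - A\<close> is orthogonal to the symmetric tensors and that the
  quadratic form of \<open>v I - L\<close> is nonnegative, where \<open>v = A \<bullet> Xs\<close>; so \<open>L\<close> is an optimal dual solution
  of (R) without duality gap, and weak duality gives tightness.  Conversely, the dual optimum has to be
  attained although (R) has no strictly feasible point when \<open>d \<ge> 4\<close> and \<open>n \<ge> 2\<close>.  Positive definiteness on
  the symmetric tensors of order \<open>d/2\<close> suffices instead: the symmetrizations of \<open>x \<otimes> x\<close> with \<open>x\<close>
  symmetric and of norm 1 form a compact set whose convex hull avoids \<open>0\<close>, because a sum of powers
  \<open>y \<otimes> \<dots> \<otimes> y\<close> is strictly positive on it (polarization).  Hence they generate a closed convex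
  cone.  The normal of a hyperplane separating it from \<open>v I - A\<close> would be, after symmetrization and
  scaling, a feasible point of (R) of value above \<open>v\<close>.
\<close>

section \<open>Symmetrization\<close>

text \<open>The same condition as in \<open>sym_tensors\<close>, for any type of index positions, so
  that it also covers the vectors of order d/2 on which \<open>Mat\<close> acts.\<close>

definition perm_inv :: "(real ^ ('k::finite \<Rightarrow> 'n::finite)) set" where
  "perm_inv = {B. \<forall>p. p permutes UNIV \<longrightarrow> (\<forall>i. B $ (i \<circ> p) = B $ i)}"

text \<open>This is the orthogonal projection onto \<open>perm_inv\<close>.\<close>

definition symz :: "real ^ ('k::finite \<Rightarrow> 'n::finite) \<Rightarrow> real ^ ('k \<Rightarrow> 'n)" where
  "symz B = (\<chi> i. (\<Sum>p | p permutes UNIV. B $ (i \<circ> p)) / fact CARD('k))"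

lemma sym_tensors_eq_perm_inv: "sym_tensors = perm_inv"
  by (simp add: sym_tensors_def perm_inv_def)

lemma perm_invD: "B \<in> perm_inv \<Longrightarrow> p permutes UNIV \<Longrightarrow> B $ (i \<circ> p) = B $ i"
  by (simp add: perm_inv_def)

lemma closed_perm_inv: "closed (perm_inv :: (real ^ ('k::finite \<Rightarrow> 'n::finite)) set)"
proof -
  have "closed {B :: real ^ ('k \<Rightarrow> 'n). B $ (i \<circ> p) = B $ i}" for i and p :: "'k \<Rightarrow> 'k"
    by (intro closed_Collect_eq continuous_intros)
  then show ?thesis
    unfolding perm_inv_def by (intro closed_Collect_all closed_Collect_imp) auto
qed

lemma subspace_perm_inv: "subspace perm_inv"
  by (auto simp: subspace_def perm_inv_def)

lemma linear_symz: "linear symz"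
  by (rule linearI)
    (auto simp: symz_def vec_eq_iff sum.distrib add_divide_distrib sum_distrib_left)

lemma symz_perm_inv: "symz B \<in> perm_inv"
proof -
  have "(\<Sum>p | p permutes UNIV. B $ (i \<circ> q \<circ> p)) = (\<Sum>p | p permutes UNIV. B $ (i \<circ> p))"
    if "q permutes UNIV" for q and i :: "'a \<Rightarrow> 'b"
    using setum_permutations_compose_left[OF that, of "\<lambda>p. B $ (i \<circ> p)"]
    by (simp add: comp_assoc)
  then show ?thesis
    by (simp add: perm_inv_def symz_def)
qed

text \<open>Permuting the positions only reorders the entries and leaves \<open>Z\<close> fixed, so
  every term of the average has the same inner product with \<open>Z\<close>.\<close>

lemma symz_inner:
  fixes B Z :: "real ^ ('k::finite \<Rightarrow> 'n::finite)"
  assumes "Z \<in> perm_inv"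
  shows "symz B \<bullet> Z = B \<bullet> Z"
proof -
  have *: "(\<Sum>i\<in>UNIV. B $ (i \<circ> p) * Z $ i) = B \<bullet> Z" if p: "p permutes UNIV" for p
  proof -
    have "bij (\<lambda>i::'k \<Rightarrow> 'n. i \<circ> p)"
      by (rule o_bij[where g = "\<lambda>i. i \<circ> inv p"])
        (use permutes_inv_o[OF p] in \<open>auto simp: fun_eq_iff permutes_inverses[OF p]\<close>)
    then have "(\<Sum>i\<in>UNIV. B $ (i \<circ> p) * Z $ (i \<circ> p)) = (\<Sum>i\<in>UNIV. B $ i * Z $ i)"
      by (rule sum.reindex_bij_betw)
    then show ?thesis
      using p by (simp add: perm_invD[OF assms] inner_vec_def)
  qed
  have "symz B \<bullet> Z
      = (\<Sum>i\<in>UNIV. \<Sum>p | p permutes UNIV. B $ (i \<circ> p) * Z $ i) / fact CARD('k)"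
    by (simp add: inner_vec_def symz_def sum_distrib_right sum_divide_distrib)
  also have "\<dots> = (\<Sum>p | p permutes UNIV. \<Sum>i\<in>UNIV. B $ (i \<circ> p) * Z $ i) / fact CARD('k)"
    by (subst sum.swap) simp
  also have "\<dots> = B \<bullet> Z"
    by (simp add: * card_permutations[OF refl])
  finally show ?thesis .
qed

lemma symz_adjoint: "symz B \<bullet> Z = B \<bullet> symz Z"
  using symz_inner[OF symz_perm_inv, of B Z] symz_inner[OF symz_perm_inv, of Z B]
  by (simp add: inner_commute)

section \<open>Polarization\<close>

definition tpow :: "real ^ 'n \<Rightarrow> real ^ ('k::finite \<Rightarrow> 'n::finite)" where
  "tpow y = (\<chi> i. \<Prod>k\<in>UNIV. y $ i k)"

lemma tpow_perm_inv: "tpow y \<in> perm_inv"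
proof -
  have "(\<Prod>k\<in>UNIV. y $ i (p k)) = (\<Prod>k\<in>UNIV. y $ i k)" if "p permutes UNIV" for p and i :: "'a \<Rightarrow> 'b"
    using permutes_bij[OF that] by (rule prod.reindex_bij_betw)
  then show ?thesis
    by (simp add: perm_inv_def tpow_def)
qed

lemma norm_tpow_axis: "norm (tpow (axis a 1) :: real ^ ('k::finite \<Rightarrow> 'n::finite)) = 1"
proof -
  have "(tpow (axis a 1) :: real ^ ('k \<Rightarrow> 'n)) = axis (\<lambda>_. a) 1"
    by (auto simp: tpow_def axis_def vec_eq_iff fun_eq_iff)
  then show ?thesis by simp
qed

text \<open>Toggling a fixed element outside \<open>T\<close> is a sign-reversing involution on the
  supersets of \<open>T\<close>, so the sum equals its own negative unless
  \<open>T = UNIV\<close>.\<close>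

lemma alternating_sum_supersets:
  fixes T :: "'k::finite set"
  shows "(\<Sum>S | T \<subseteq> S. (- 1) ^ card S :: real) = (if T = UNIV then (- 1) ^ CARD('k) else 0)"
proof (cases "T = UNIV")
  case True
  then have "{S. T \<subseteq> S} = {UNIV}" by auto
  then show ?thesis using True by simp
next
  case False
  then obtain j where j: "j \<notin> T" by auto
  define h where "h S = (if j \<in> S then S - {j} else insert j S)" for S :: "'k set"
  have sgn: "(- 1) ^ card (h S) = - ((- 1) ^ card S :: real)" for S
  proof (cases "j \<in> S")
    case True
    then have "card S = Suc (card (h S))"
      using card.remove[of S j] by (simp add: h_def)
    then show ?thesis by simp
  qed (simp add: h_def)
  have "bij_betw h {S. T \<subseteq> S} {S. T \<subseteq> S}"
    by (rule bij_betw_byWitness[where f' = h]) (use j in \<open>auto simp: h_def\<close>)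
  then have "(\<Sum>S | T \<subseteq> S. (- 1) ^ card (h S) :: real) = (\<Sum>S | T \<subseteq> S. (- 1) ^ card S)"
    by (rule sum.reindex_bij_betw)
  then show ?thesis
    using False by (simp add: sgn sum_negf)
qed

text \<open>Expanding the product of sums, \<open>g\<close> records which summand
  \<open>axis (i j) 1\<close> is chosen at each position.\<close>

lemma inner_tpow_sum_axis:
  fixes x :: "real ^ ('k::finite \<Rightarrow> 'n::finite)" and i :: "'k \<Rightarrow> 'n"
  shows "x \<bullet> tpow (\<Sum>j\<in>S. axis (i j) 1) = (\<Sum>g | range g \<subseteq> S. x $ (i \<circ> g))"
proof -
  have "tpow (\<Sum>j\<in>S. axis (i j) 1) $ r = (\<Sum>g | range g \<subseteq> S. if r = i \<circ> g then 1 else (0::real))"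
    for r :: "'k \<Rightarrow> 'n"
  proof -
    have "tpow (\<Sum>j\<in>S. axis (i j) 1) $ r = (\<Prod>k\<in>UNIV. \<Sum>j\<in>S. if r k = i j then 1 else (0::real))"
      by (simp add: tpow_def axis_def eq_commute)
    also have "\<dots> = (\<Sum>g\<in>PiE UNIV (\<lambda>_. S). \<Prod>k\<in>UNIV. if r k = i (g k) then 1 else (0::real))"
      by (rule prod_sum_PiE) auto
    also have "PiE UNIV (\<lambda>_. S) = {g :: 'k \<Rightarrow> 'k. range g \<subseteq> S}"
      by (auto simp: PiE_def Pi_def)
    also have "(\<lambda>g. \<Prod>k\<in>UNIV. if r k = i (g k) then 1 else (0::real)) = (\<lambda>g. if r = i \<circ> g then 1 else 0)"
      by (auto simp: fun_eq_iff)
    finally show ?thesis .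
  qed
  then have "x \<bullet> tpow (\<Sum>j\<in>S. axis (i j) 1)
      = (\<Sum>r\<in>UNIV. \<Sum>g | range g \<subseteq> S. if r = i \<circ> g then x $ r else 0)"
    by (simp add: inner_vec_def sum_distrib_left if_distrib cong: if_cong)
  also have "\<dots> = (\<Sum>g | range g \<subseteq> S. x $ (i \<circ> g))"
    by (subst sum.swap) simp
  finally show ?thesis .
qed

text \<open>Inclusion-exclusion over \<open>S\<close> leaves only the surjective \<open>g\<close>,
  which are the permutations, and each of them contributes the same entry by symmetry. Hence a
  symmetric tensor orthogonal to all these powers vanishes.\<close>

lemma polarization:
  fixes x :: "real ^ ('k::finite \<Rightarrow> 'n::finite)" and i :: "'k \<Rightarrow> 'n"
  assumes "x \<in> perm_inv"
  shows "(\<Sum>S\<in>UNIV. (- 1) ^ card S * (x \<bullet> tpow (\<Sum>j\<in>S. axis (i j) 1)))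
      = (- 1) ^ CARD('k) * fact CARD('k) * x $ i"
proof -
  have "(\<Sum>S\<in>UNIV. (- 1) ^ card S * (x \<bullet> tpow (\<Sum>j\<in>S. axis (i j) 1)))
      = (\<Sum>S\<in>UNIV. \<Sum>g | range g \<subseteq> S. (- 1) ^ card S * x $ (i \<circ> g))"
    by (simp add: inner_tpow_sum_axis sum_distrib_left)
  also have "\<dots> = (\<Sum>g\<in>UNIV. \<Sum>S | range g \<subseteq> S. (- 1) ^ card S * x $ (i \<circ> g))"
    using sum.swap_restrict[of UNIV UNIV "\<lambda>S g. (- 1) ^ card S * x $ (i \<circ> g)" "\<lambda>S g. range g \<subseteq> S"]
    by simp
  also have "\<dots> = (\<Sum>g\<in>UNIV. if range g = UNIV then (- 1) ^ CARD('k) * x $ (i \<circ> g) else 0)"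
    by (simp add: sum_distrib_right[symmetric] alternating_sum_supersets if_distrib[of "\<lambda>t. t * _"] cong: if_cong)
  also have "\<dots> = (\<Sum>g | g permutes UNIV. (- 1) ^ CARD('k) * x $ (i \<circ> g))"
  proof -
    have "{g :: 'k \<Rightarrow> 'k. range g = UNIV} = {g. g permutes UNIV}"
      by (auto simp: bij_def intro!: bij_imp_permutes finite_UNIV_surj_inj dest: permutes_surj)
    then show ?thesis
      by (simp add: sum.If_cases)
  qed
  also have "\<dots> = (- 1) ^ CARD('k) * fact CARD('k) * x $ i"
    by (simp add: perm_invD[OF assms] card_permutations[OF refl])
  finally show ?thesis .
qed

section \<open>Rank-one matrices and positive semidefinite matrices\<close>

text \<open>Under \<open>Mat\<close> this is the matrix of \<open>x\<close> times its
  transpose.\<close>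

definition outer :: "real ^ ('m \<Rightarrow> 'n) \<Rightarrow> ('m::finite, 'n::finite) tensor" where
  "outer x = (\<chi> i. x $ (i \<circ> Inl) * x $ (i \<circ> Inr))"

lemma Mat_nth [simp]: "Mat B $ r $ c = B $ case_sum r c"
  by (simp add: Mat_def)

lemma outer_nth_case_sum [simp]: "outer x $ case_sum r c = x $ r * x $ c"
  by (simp add: outer_def case_sum_o_inj)

lemma tensor_eq_iff: "X = Y \<longleftrightarrow> (\<forall>r c. X $ case_sum r c = Y $ case_sum r c)"
proof -
  have "X $ i = Y $ i" if "\<forall>r c. X $ case_sum r c = Y $ case_sum r c" for i
    using that by (metis surjective_sum)
  then show ?thesis by (auto simp: vec_eq_iff)
qed

lemma inner_tensor:
  "X \<bullet> Y = (\<Sum>r\<in>UNIV. \<Sum>c\<in>UNIV. X $ case_sum r c * Y $ case_sum r c)"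
proof -
  have "bij_betw (\<lambda>(r, c). case_sum r c) (UNIV \<times> UNIV) (UNIV :: ('a + 'b \<Rightarrow> 'c) set)"
    by (rule bij_betw_byWitness[where f' = "\<lambda>i. (i \<circ> Inl, i \<circ> Inr)"])
      (auto simp: case_sum_o_inj fun_eq_iff split: sum.splits)
  from sum.reindex_bij_betw[OF this, of "\<lambda>i. X $ i * Y $ i"] show ?thesis
    by (simp add: inner_vec_def sum.cartesian_product case_prod_unfold)
qed

lemma inner_matrix_vector:
  fixes M :: "real ^ 'k ^ 'k"
  shows "u \<bullet> (M *v v) = (\<Sum>r\<in>UNIV. \<Sum>c\<in>UNIV. u $ r * M $ r $ c * v $ c)"
  by (simp add: inner_vec_def matrix_vector_mult_def sum_distrib_left mult.assoc)

lemma outer_inner: "outer x \<bullet> B = x \<bullet> (Mat B *v x)"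
  unfolding inner_tensor inner_matrix_vector by (intro sum.cong refl) simp

lemma outer_inner_outer: "outer x \<bullet> outer y = (x \<bullet> y)\<^sup>2"
  by (simp add: inner_tensor inner_vec_def power2_eq_square sum_product mult_ac)

text \<open>The two powers have different orders: d/2 on the left, d on the right.\<close>

lemma outer_tpow: "outer (tpow y) = tpow y"
  by (simp add: tpow_def outer_def vec_eq_iff UNIV_Plus_UNIV[symmetric] prod.Plus del: UNIV_Plus_UNIV)

lemma outer_inner_tpow: "outer x \<bullet> tpow y = (x \<bullet> tpow y)\<^sup>2"
  by (metis outer_inner_outer outer_tpow)

lemma outer_scaleR: "outer (c *\<^sub>R x) = c\<^sup>2 *\<^sub>R outer x"
  by (simp add: outer_def vec_eq_iff power2_eq_square)

lemma continuous_on_outer: "continuous_on S outer"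
  unfolding outer_def by (intro continuous_intros)

lemma trace_Mat_outer: "trace (Mat (outer x)) = (norm x)\<^sup>2"
  by (simp add: trace_def power2_norm_eq_inner inner_vec_def)

text \<open>Rank one makes all columns multiples of one vector \<open>u\<close>, symmetry makes the
  coefficients proportional to \<open>u\<close>, and trace 1 makes the factor positive, so its
  square root can be absorbed into \<open>u\<close>.\<close>

lemma C_set_eq: "C_set = outer ` {x. norm x = 1}"
proof (intro equalityI subsetI)
  fix X :: "('a, 'b) tensor"
  assume "X \<in> C_set"
  then have rk: "dim (columns (Mat X)) = 1" and sym: "transpose (Mat X) = Mat X"
    and tr: "trace (Mat X) = 1"
    by (auto simp: C_set_def column_rank_def)
  obtain u where u: "columns (Mat X) \<subseteq> span {u}"
  proof -
    obtain B where B: "columns (Mat X) \<subseteq> span B" "card B = 1"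
      using basis_exists[of "columns (Mat X)"] rk by metis
    then show ?thesis
      using that by (metis card_1_singletonE)
  qed
  have "\<exists>k. column c (Mat X) = k *\<^sub>R u" for c
    using u by (auto simp: columns_def span_singleton)
  then obtain w where w: "\<And>c. column c (Mat X) = w c *\<^sub>R u"
    by metis
  have X: "X $ case_sum r c = w c * u $ r" for r c
    using arg_cong[OF w[of c], of "\<lambda>v. v $ r"] by (simp add: column_def)
  have comm: "w c * u $ r = w r * u $ c" for r c
    using arg_cong[OF sym, of "\<lambda>M. M $ c $ r"] by (simp add: transpose_def X)
  have tr': "(\<Sum>r\<in>UNIV. w r * u $ r) = 1"
    using tr by (simp add: trace_def X)
  then obtain j where j: "u $ j \<noteq> 0"
    by (cases "u = 0") (auto simp: vec_eq_iff)
  define k where "k = w j / u $ j"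
  have wk: "w c = k * u $ c" for c
    using comm[of c j] j by (simp add: k_def field_simps)
  have one: "k * (u \<bullet> u) = 1"
    using tr' by (simp add: wk inner_vec_def sum_distrib_left mult.assoc)
  then have "k > 0"
    using inner_ge_zero[of u] mult_nonpos_nonneg[of k "u \<bullet> u"] by linarith
  then have "X = outer (sqrt k *\<^sub>R u)"
    by (simp add: outer_scaleR tensor_eq_iff X wk mult_ac)
  moreover have "norm (sqrt k *\<^sub>R u) = 1"
    using one \<open>k > 0\<close> by (simp add: norm_eq_1 mult.assoc[symmetric] del: norm_scaleR)
  ultimately show "X \<in> outer ` {x. norm x = 1}" by blast
next
  fix X :: "('a, 'b) tensor"
  assume "X \<in> outer ` {x. norm x = 1}"
  then obtain x where X: "X = outer x" and x: "norm x = 1" by auto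
  have "column c (Mat X) = x $ c *\<^sub>R x" for c
    by (simp add: column_def X vec_eq_iff)
  then have "columns (Mat X) \<subseteq> span {x}"
    by (auto simp: columns_def span_singleton)
  then have "rank (Mat X) \<le> 1"
    unfolding column_rank_def using dim_le_card[of "columns (Mat X)" "{x}"] by simp
  moreover have tr: "trace (Mat X) = 1"
    by (simp add: X trace_Mat_outer x)
  then have "rank (Mat X) \<noteq> 0"
    by (auto simp: rank_eq_0 trace_def simp del: Mat_nth)
  ultimately show "X \<in> C_set"
    using tr by (simp add: C_set_def X vec_eq_iff transpose_def mult.commute)
qed

section \<open>Positive semidefinite matrices: diagonal, Cauchy-Schwarz, pairing with nonnegative
  forms\<close>

lemma psd_quadratic_sum:
  fixes M :: "real ^ 'k ^ 'k"
  assumes "psd M"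
  shows "0 \<le> (\<Sum>i\<in>UNIV. \<Sum>j\<in>UNIV. v i * M $ i $ j * v j)"
proof -
  have "0 \<le> (\<chi> i. v i) \<bullet> (M *v (\<chi> i. v i))"
    using assms by (simp add: psd_def)
  then show ?thesis by (simp add: inner_matrix_vector)
qed

lemma psd_sym: "psd M \<Longrightarrow> M $ i $ j = M $ j $ i"
  unfolding psd_def by (metis transpose_def vec_lambda_beta)

lemma psd_inner_axis:
  assumes "psd M"
  shows "(v + t *\<^sub>R axis j 1) \<bullet> (M *v (v + t *\<^sub>R axis j 1))
    = v \<bullet> (M *v v) + 2 * t * (M *v v) $ j + t\<^sup>2 * M $ j $ j"
proof -
  have "v \<bullet> (M *v axis j 1) = (M *v v) $ j"
    unfolding matrix_vector_mult_basis
    by (simp add: inner_vec_def column_def matrix_vector_mult_def psd_sym[OF assms, of j] mult.commute)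
  then show ?thesis
    by (simp add: matrix_vector_right_distrib matrix_vector_mult_scaleR inner_add_left inner_add_right
        inner_axis' matrix_vector_mult_basis column_def power2_eq_square algebra_simps)
qed

lemma psd_diag_nonneg: "psd M \<Longrightarrow> 0 \<le> M $ j $ j"
  using psd_quadratic_sum[of M "\<lambda>i. if i = j then 1 else 0"]
  by (simp add: if_distrib[of "\<lambda>t. t * _"] if_distrib[of "\<lambda>t. _ * t"] cong: if_cong)

lemma psd_cauchy:
  assumes "psd M" "M $ j $ j \<noteq> 0"
  shows "((M *v v) $ j)\<^sup>2 / M $ j $ j \<le> v \<bullet> (M *v v)"
proof -
  \<comment> \<open>The minimizer of the quadratic polynomial in \<open>t\<close> from
    \<open>psd_inner_axis\<close>.\<close>
  define t where "t = - ((M *v v) $ j) / M $ j $ j"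
  have "0 \<le> v \<bullet> (M *v v) + 2 * t * (M *v v) $ j + t\<^sup>2 * M $ j $ j"
    using assms(1) psd_inner_axis[OF assms(1), of v t j] unfolding psd_def by metis
  then show ?thesis
    using assms(2) by (simp add: t_def power2_eq_square diff_divide_distrib)
qed

lemma psd_zero_diag:
  assumes "psd M" "M $ j $ j = 0"
  shows "M $ i $ j = 0"
proof (rule ccontr)
  assume ne: "M $ i $ j \<noteq> 0"
  \<comment> \<open>With a zero diagonal entry the form is affine in \<open>t\<close>; this choice
    gives it the value -1.\<close>
  define t where "t = - (M $ i $ i + 1) / (2 * M $ i $ j)"
  have "0 \<le> axis i 1 \<bullet> (M *v axis i 1) + 2 * t * (M *v axis i 1) $ j + t\<^sup>2 * M $ j $ j"
    using assms(1) psd_inner_axis[OF assms(1), of "axis i 1" t j] unfolding psd_def by metis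
  then have "0 \<le> M $ i $ i + 2 * t * M $ i $ j"
    by (simp add: assms(2) inner_axis' matrix_vector_mult_basis column_def psd_sym[OF assms(1), of j i])
  then show False
    using ne by (simp add: t_def field_simps)
qed

lemma psd_trace_0:
  assumes "psd M" "trace M = 0"
  shows "M = 0"
proof -
  have "M $ j $ j = 0" for j
    using assms(2) sum_nonneg_eq_0_iff[of UNIV "\<lambda>j. M $ j $ j"] psd_diag_nonneg[OF assms(1)]
    by (simp add: trace_def)
  then show ?thesis
    using psd_zero_diag[OF assms(1)] by (simp add: vec_eq_iff)
qed

text \<open>Peeling off one column by a Schur complement replaces the spectral theorem.\<close>

lemma psd_entrywise_inner_nonneg:
  fixes M W :: "real ^ 'k ^ 'k"
  assumes "psd M" "\<And>v. 0 \<le> v \<bullet> (W *v v)"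
  shows "0 \<le> (\<Sum>i\<in>UNIV. \<Sum>j\<in>UNIV. W $ i $ j * M $ i $ j)"
  using assms(1)
proof (induction "card {j. M $ j $ j \<noteq> 0}" arbitrary: M rule: less_induct)
  case less
  show ?case
  proof (cases "\<exists>j. M $ j $ j \<noteq> 0")
    case False
    then have "M $ i $ j = 0" for i j
      using psd_zero_diag[OF less.prems] by blast
    then show ?thesis by simp
  next
    case True
    then obtain l where l: "M $ l $ l \<noteq> 0" by blast
    \<comment> \<open>Subtracting the rank-one part of column \<open>l\<close> keeps the matrix
      positive semidefinite by \<open>psd_cauchy\<close>, clears the diagonal entry at
      \<open>l\<close> and leaves zero diagonal entries zero, so the induction applies.\<close>
    define N :: "real ^ 'k ^ 'k" where "N = (\<chi> i j. M $ i $ j - M $ i $ l * M $ j $ l / M $ l $ l)"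
    have Nv: "v \<bullet> (N *v v) = v \<bullet> (M *v v) - ((M *v v) $ l)\<^sup>2 / M $ l $ l" for v
    proof -
      have "(M *v v) $ l = (\<Sum>i\<in>UNIV. v $ i * M $ i $ l)"
        by (simp add: matrix_vector_mult_def psd_sym[OF less.prems, of l] mult.commute)
      then have "((M *v v) $ l)\<^sup>2 / M $ l $ l
          = (\<Sum>i\<in>UNIV. \<Sum>j\<in>UNIV. v $ i * (M $ i $ l * M $ j $ l / M $ l $ l) * v $ j)"
        by (simp add: power2_eq_square sum_product sum_divide_distrib mult_ac)
      then show ?thesis
        by (simp add: inner_matrix_vector N_def sum_subtractf algebra_simps)
    qed
    have "psd N"
      unfolding psd_def Nv using psd_cauchy[OF less.prems l]
      by (auto simp: N_def transpose_def vec_eq_iff psd_sym[OF less.prems] mult.commute)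
    moreover have "card {j. N $ j $ j \<noteq> 0} < card {j. M $ j $ j \<noteq> 0}"
    proof (rule psubset_card_mono)
      have "N $ j $ j = 0" if "M $ j $ j = 0" for j
        using that psd_zero_diag[OF less.prems that, of l] psd_sym[OF less.prems, of j l]
        by (simp add: N_def)
      moreover have "N $ l $ l = 0" using l by (simp add: N_def)
      ultimately show "{j. N $ j $ j \<noteq> 0} \<subset> {j. M $ j $ j \<noteq> 0}"
        using l by blast
    qed simp
    ultimately have N: "0 \<le> (\<Sum>i\<in>UNIV. \<Sum>j\<in>UNIV. W $ i $ j * N $ i $ j)"
      using less.hyps by blast
    \<comment> \<open>The part removed pairs with \<open>W\<close> to the form of \<open>W\<close>
      at column \<open>l\<close> of \<open>M\<close>, divided by a positive number.\<close>
    have "0 \<le> (\<Sum>i\<in>UNIV. \<Sum>j\<in>UNIV. M $ i $ l * W $ i $ j * M $ j $ l) / M $ l $ l"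
      using assms(2)[of "\<chi> i. M $ i $ l"] psd_diag_nonneg[OF less.prems, of l]
      by (simp add: inner_matrix_vector)
    also have "\<dots> = (\<Sum>i\<in>UNIV. \<Sum>j\<in>UNIV. W $ i $ j * (M $ i $ l * M $ j $ l / M $ l $ l))"
      by (simp add: sum_divide_distrib mult_ac)
    also have "\<dots> = (\<Sum>i\<in>UNIV. \<Sum>j\<in>UNIV. W $ i $ j * M $ i $ j) - (\<Sum>i\<in>UNIV. \<Sum>j\<in>UNIV. W $ i $ j * N $ i $ j)"
      by (simp add: N_def sum_subtractf[symmetric] algebra_simps)
    finally show ?thesis using N by simp
  qed
qed

lemma psd_Mat_inner_nonneg:
  assumes "psd (Mat X)" "\<And>x. 0 \<le> outer x \<bullet> W"
  shows "0 \<le> W \<bullet> X"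
  using psd_entrywise_inner_nonneg[OF assms(1), of "Mat W"] assms(2)[unfolded outer_inner]
  by (simp add: inner_tensor)

section \<open>Symmetric tensors as quadratic forms\<close>

lemma case_sum_permute_rows: "case_sum (r \<circ> p) c = case_sum r c \<circ> map_sum p id"
  by (auto simp: fun_eq_iff split: sum.splits)

lemma permutes_map_sum_id: "p permutes UNIV \<Longrightarrow> map_sum p id permutes UNIV"
  by (intro bij_imp_permutes o_bij[where g = "map_sum (inv p) id"])
    (auto simp: fun_eq_iff split_sum_all permutes_inverses)

lemma sym_tensors_swap:
  assumes "Z \<in> sym_tensors"
  shows "Z $ case_sum c r = Z $ case_sum r c"
proof -
  let ?s = "case_sum Inr Inl :: 'a + 'a \<Rightarrow> 'a + 'a"
  have "bij ?s"
    by (rule o_bij[where g = ?s]) (auto simp: fun_eq_iff split: sum.splits)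
  then have "?s permutes UNIV"
    by (simp add: permutes_univ bij_iff)
  moreover have "case_sum c r = case_sum r c \<circ> ?s"
    by (auto simp: fun_eq_iff split: sum.splits)
  ultimately show ?thesis
    using assms by (simp add: sym_tensors_def)
qed

lemma transpose_Mat_sym_tensors: "Z \<in> sym_tensors \<Longrightarrow> transpose (Mat Z) = Mat Z"
  by (simp add: vec_eq_iff transpose_def sym_tensors_swap)

text \<open>For symmetric \<open>Z\<close> every \<open>Mat Z *v y\<close> is symmetric of order
  d/2, so \<open>x\<close> may be replaced by \<open>symz x\<close> in one argument of the bilinear
  form and then in the other.\<close>

lemma outer_symz_inner:
  assumes Z: "Z \<in> sym_tensors"
  shows "outer (symz x) \<bullet> Z = outer x \<bullet> Z"
proof -
  have inv: "Mat Z *v y \<in> perm_inv" for y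
    using Z by (auto simp: perm_inv_def sym_tensors_def matrix_vector_mult_def case_sum_permute_rows
        permutes_map_sum_id)
  have sw: "u \<bullet> (Mat Z *v v) = v \<bullet> (Mat Z *v u)" for u v
    using transpose_Mat_sym_tensors[OF Z] by (metis dot_lmul_matrix inner_commute transpose_matrix_vector)
  have "symz x \<bullet> (Mat Z *v symz x) = x \<bullet> (Mat Z *v symz x)"
    by (rule symz_inner[OF inv])
  also have "\<dots> = symz x \<bullet> (Mat Z *v x)" by (rule sw)
  also have "\<dots> = x \<bullet> (Mat Z *v x)" by (rule symz_inner[OF inv])
  finally show ?thesis by (simp add: outer_inner)
qed

text \<open>The form takes the same value at \<open>x\<close> and \<open>symz x\<close>, and scaling
  reduces to norm 1. Thus only the vectors of \<open>sym_sphere\<close> have to be tested.\<close>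

lemma psd_Mat_symI:
  assumes Z: "Z \<in> sym_tensors"
    and pos: "\<And>x. norm x = 1 \<Longrightarrow> x \<in> perm_inv \<Longrightarrow> 0 \<le> outer x \<bullet> Z"
  shows "psd (Mat Z)"
proof -
  have "0 \<le> outer x \<bullet> Z" for x
  proof -
    define y where "y = symz x"
    have "0 \<le> outer y \<bullet> Z"
    proof (cases "y = 0")
      case True
      then show ?thesis by (simp add: outer_inner)
    next
      case False
      define z where "z = y /\<^sub>R norm y"
      have "z \<in> perm_inv"
        unfolding z_def y_def by (intro subspace_scale subspace_perm_inv symz_perm_inv)
      moreover have "norm z = 1" using False by (simp add: z_def)
      ultimately have "0 \<le> (norm y)\<^sup>2 * (outer z \<bullet> Z)" using pos by simp
      moreover have "outer y = (norm y)\<^sup>2 *\<^sub>R outer z"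
        using False by (simp add: z_def outer_scaleR[symmetric])
      ultimately show ?thesis by simp
    qed
    then show ?thesis by (simp add: y_def outer_symz_inner[OF Z])
  qed
  then show ?thesis
    using transpose_Mat_sym_tensors[OF Z] by (simp add: psd_def outer_inner)
qed

section \<open>The cone of symmetrized positive semidefinite tensors\<close>

text \<open>Only symmetric \<open>x\<close> are admitted: other \<open>x\<close> may have \<open>symz (outer x) = 0\<close>, and then the cone over
  the base would not obviously be closed.\<close>

definition sym_sphere :: "(real ^ ('m::finite \<Rightarrow> 'n::finite)) set" where
  "sym_sphere = {x. norm x = 1} \<inter> perm_inv"

definition sos_base :: "('m::finite, 'n::finite) tensor set" where
  "sos_base = convex hull (symz ` outer ` sym_sphere)"

lemma compact_sym_sphere: "compact sym_sphere"
  unfolding sym_sphere_def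
  by (intro compact_Int_closed closed_perm_inv) (use compact_sphere[of 0 1] in \<open>simp add: sphere_def\<close>)

lemma compact_sos_base: "compact sos_base"
  unfolding sos_base_def
  by (intro compact_convex_hull compact_continuous_image continuous_on_outer compact_sym_sphere
      linear_continuous_on linear_symz[unfolded linear_conv_bounded_linear])

text \<open>The powers of the test vectors occurring in the polarization identity add up to a symmetric
  tensor whose quadratic form is positive definite on symmetric tensors of order \<open>d/2\<close>.\<close>

lemma zero_notin_sos_base: "(0 :: ('m::finite, 'n::finite) tensor) \<notin> sos_base"
proof -
  define y :: "('m \<Rightarrow> 'n) \<Rightarrow> 'm set \<Rightarrow> real ^ 'n" where "y i S = (\<Sum>j\<in>S. axis (i j) 1)" for i S
  define Z :: "('m, 'n) tensor" where "Z = (\<Sum>i\<in>UNIV. \<Sum>S\<in>UNIV. tpow (y i S))"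
  have Z: "Z \<in> perm_inv"
    unfolding Z_def by (intro subspace_sum subspace_perm_inv tpow_perm_inv)
  have "0 < Z \<bullet> symz (outer x)" if "x \<in> sym_sphere" for x :: "real ^ ('m \<Rightarrow> 'n)"
  proof -
    have x: "x \<in> perm_inv" "x \<noteq> 0" using that by (auto simp: sym_sphere_def)
    then obtain i where i: "x $ i \<noteq> 0" by (auto simp: vec_eq_iff)
    \<comment> \<open>Otherwise polarization would force the entry of \<open>x\<close> at
      \<open>i\<close> to be 0.\<close>
    obtain S where S: "x \<bullet> tpow (y i S) \<noteq> 0"
    proof (rule ccontr)
      assume "\<not> thesis"
      then have "x \<bullet> tpow (y i S) = 0" for S using that by blast
      then show False
        using polarization[OF x(1), of i] i by (simp add: y_def)
    qed
    have "Z \<bullet> symz (outer x) = outer x \<bullet> Z"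
      using symz_inner[OF Z] by (simp add: inner_commute)
    \<comment> \<open>The form of \<open>Z\<close> is a sum of squares, and the one for
      \<open>i\<close> and \<open>S\<close> is nonzero.\<close>
    also have "\<dots> = (\<Sum>i\<in>UNIV. \<Sum>S\<in>UNIV. (x \<bullet> tpow (y i S))\<^sup>2)"
      by (simp add: Z_def inner_sum_right outer_inner_tpow)
    also have "\<dots> > 0"
      using S by (intro sum_pos2[of _ i] sum_pos2[of _ S] sum_nonneg) auto
    finally show ?thesis .
  qed
  then have "sos_base \<subseteq> {B. 0 < Z \<bullet> B}"
    unfolding sos_base_def by (intro hull_minimal) (auto simp: convex_halfspace_gt)
  then show ?thesis by auto
qed

lemma sos_base_nonempty: "sos_base \<noteq> {}"
  using tpow_perm_inv norm_tpow_axis by (auto simp: sos_base_def sym_sphere_def)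

text \<open>Convex hulls commute with the linear map \<open>symz\<close>, so \<open>h\<close> lifts
  to a convex combination of tensors \<open>outer x\<close>. The lift is what carries the
  nonnegative form, since symmetrization can destroy it.\<close>

lemma sos_base_symz:
  fixes h :: "('m::finite, 'n::finite) tensor"
  assumes "h \<in> sos_base"
  obtains W where "symz W = h" "\<And>x. 0 \<le> outer x \<bullet> W"
proof -
  have "sos_base = symz ` (convex hull (outer ` (sym_sphere :: (real ^ ('m \<Rightarrow> 'n)) set)))"
    unfolding sos_base_def by (rule convex_hull_linear_image[OF linear_symz, symmetric])
  then have "h \<in> symz ` (convex hull (outer ` (sym_sphere :: (real ^ ('m \<Rightarrow> 'n)) set)))"
    using assms by (simp only:)
  then obtain W where W: "W \<in> convex hull (outer ` sym_sphere)" "symz W = h"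
    by (elim imageE) simp
  have "convex hull (outer ` sym_sphere) \<subseteq> {W. 0 \<le> outer x \<bullet> W}" for x :: "real ^ ('m \<Rightarrow> 'n)"
    by (intro hull_minimal) (auto simp: outer_inner_outer convex_halfspace_ge)
  with W that show ?thesis by blast
qed

lemma separation_sos_cone:
  fixes G :: "('m::finite, 'n::finite) tensor"
  assumes "symz G \<notin> conic hull sos_base"
  obtains Z where "Z \<in> sym_tensors" "psd (Mat Z)" "Z \<bullet> G < 0"
proof -
  let ?K = "conic hull (sos_base :: ('m, 'n) tensor set)"
  have "convex ?K" by (simp add: convex_conic_hull sos_base_def)
  \<comment> \<open>A cone generated by a compact set that avoids 0 is closed.\<close>
  moreover have "closed ?K"
    by (intro closed_conic_hull disjI2 conjI compact_sos_base zero_notin_sos_base)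
  ultimately obtain a b where ab: "a \<bullet> symz G < b" "\<And>w. w \<in> ?K \<Longrightarrow> b < a \<bullet> w"
    using separating_hyperplane_closed_point[of ?K "symz G"] assms by blast
  have "0 \<in> ?K" using sos_base_nonempty by (simp add: conic_hull_contains_0)
  then have b: "b < 0" using ab(2)[of 0] by simp
  have pos: "0 \<le> a \<bullet> w" if "w \<in> sos_base" for w
  proof (rule ccontr)
    assume neg: "\<not> 0 \<le> a \<bullet> w"
    \<comment> \<open>Stretching \<open>w\<close> reaches the level \<open>b\<close> exactly,
      against the strict separation.\<close>
    have "(b / (a \<bullet> w)) *\<^sub>R w \<in> ?K"
      using neg b by (intro conic_mul conic_conic_hull hull_inc that) (simp add: divide_nonpos_neg)
    from ab(2)[OF this] neg show False by simp
  qed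
  show ?thesis
  proof
    \<comment> \<open>The normal may be symmetrized: \<open>symz\<close> is self-adjoint, and
      \<open>a\<close> was only paired with symmetrized tensors.\<close>
    show Z: "symz a \<in> sym_tensors" by (simp add: sym_tensors_eq_perm_inv symz_perm_inv)
    show "psd (Mat (symz a))"
    proof (rule psd_Mat_symI[OF Z])
      fix x :: "real ^ ('m \<Rightarrow> 'n)"
      assume "norm x = 1" "x \<in> perm_inv"
      then have "symz (outer x) \<in> sos_base"
        unfolding sos_base_def by (intro hull_inc) (simp add: sym_sphere_def)
      then show "0 \<le> outer x \<bullet> symz a"
        using pos by (simp add: symz_adjoint inner_commute[of "outer x"])
    qed
    show "symz a \<bullet> G < 0" using ab(1) b by (simp add: symz_adjoint)
  qed
qed

section \<open>Tightness and dual certificates\<close>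

text \<open>Its \<open>Mat\<close> is the identity matrix. As a tensor it is in general not
  symmetric, hence the \<open>symz\<close> in the dual certificate.\<close>

definition trace_tensor :: "('m::finite, 'n::finite) tensor" where
  "trace_tensor = (\<chi> i. if i \<circ> Inl = i \<circ> Inr then 1 else 0)"

lemma trace_tensor_inner: "trace_tensor \<bullet> X = trace (Mat X)"
  by (simp add: inner_tensor trace_tensor_def case_sum_o_inj trace_def if_distrib[of "\<lambda>t. t * _"] cong: if_cong)

section \<open>Feasible sets and attainment in (O)\<close>

lemma feasible_O_eq: "feasible_O = C_set \<inter> sym_tensors"
  using transpose_Mat_sym_tensors by (auto simp: feasible_O_def C_set_def)

lemma feasible_O_subset_R: "feasible_O \<subseteq> feasible_R"
proof
  fix X :: "('a, 'b) tensor"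
  assume "X \<in> feasible_O"
  then obtain x where "X = outer x" "X \<in> sym_tensors" "trace (Mat X) = 1"
    by (auto simp: feasible_O_eq C_set_eq trace_Mat_outer)
  then show "X \<in> feasible_R"
    by (auto simp: feasible_R_def outer_inner_outer intro!: psd_Mat_symI)
qed

lemma feasible_O_compact: "compact feasible_O"
  unfolding feasible_O_eq C_set_eq sym_tensors_eq_perm_inv
  by (intro compact_Int_closed closed_perm_inv compact_continuous_image continuous_on_outer)
    (use compact_sphere[of 0 1] in \<open>simp add: sphere_def\<close>)

lemma feasible_O_nonempty: "(feasible_O :: ('m::finite, 'n::finite) tensor set) \<noteq> {}"
proof -
  have "(tpow (axis undefined 1) :: ('m, 'n) tensor) \<in> C_set"
    unfolding C_set_eq
    by (rule image_eqI[where x = "tpow (axis undefined 1)"]) (simp_all add: outer_tpow norm_tpow_axis)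
  then show ?thesis
    using tpow_perm_inv by (auto simp: feasible_O_eq sym_tensors_eq_perm_inv)
qed

lemma max_value_eq:
  assumes "X \<in> F" "\<And>Y. Y \<in> F \<Longrightarrow> A \<bullet> Y \<le> A \<bullet> X"
  shows "max_value A F = ereal (A \<bullet> X)"
  unfolding max_value_def using assms by (intro antisym SUP_least SUP_upper) auto

text \<open>By compactness (O) attains its value, so equality of the two suprema means that some
  feasible point of (O) is optimal for (R).\<close>

lemma tight_iff: "tight A \<longleftrightarrow> (\<exists>X\<in>feasible_O. \<forall>Y\<in>feasible_R. A \<bullet> Y \<le> A \<bullet> X)"
proof
  assume "tight A"
  have "continuous_on feasible_O (\<lambda>Y. A \<bullet> Y)"
    by (intro continuous_intros)
  then obtain X where X: "X \<in> feasible_O" "\<And>Y. Y \<in> feasible_O \<Longrightarrow> A \<bullet> Y \<le> A \<bullet> X"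
    using continuous_attains_sup[OF feasible_O_compact feasible_O_nonempty] by blast
  have "ereal (A \<bullet> Y) \<le> ereal (A \<bullet> X)" if "Y \<in> feasible_R" for Y
    using \<open>tight A\<close> SUP_upper[OF that, of "\<lambda>Y. ereal (A \<bullet> Y)"] max_value_eq[OF X]
    by (simp add: tight_def max_value_def)
  with X show "\<exists>X\<in>feasible_O. \<forall>Y\<in>feasible_R. A \<bullet> Y \<le> A \<bullet> X" by auto
next
  assume "\<exists>X\<in>feasible_O. \<forall>Y\<in>feasible_R. A \<bullet> Y \<le> A \<bullet> X"
  then obtain X where X: "X \<in> feasible_O" "\<And>Y. Y \<in> feasible_R \<Longrightarrow> A \<bullet> Y \<le> A \<bullet> X" by blast
  then have "max_value A feasible_R = A \<bullet> X" "max_value A feasible_O = A \<bullet> X"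
    using feasible_O_subset_R by (auto intro!: max_value_eq)
  then show "tight A" by (simp add: tight_def)
qed

section \<open>Weak duality, and strong duality with dual attainment\<close>

lemma equilibrium_imp_R_optimal:
  fixes A L X :: "('m::finite, 'n::finite) tensor"
  assumes X: "X \<in> sym_tensors"
    and C: "\<And>Y. Y \<in> C_set \<Longrightarrow> L \<bullet> Y \<le> L \<bullet> X"
    and S: "\<And>Y. Y \<in> sym_tensors \<Longrightarrow> 0 \<le> (- A + L) \<bullet> (Y - X)"
    and Y: "Y \<in> feasible_R"
  shows "A \<bullet> Y \<le> A \<bullet> X"
proof -
  have sub: "subspace sym_tensors" by (simp add: sym_tensors_eq_perm_inv subspace_perm_inv)
  \<comment> \<open>Testing with \<open>X + Y\<close> and \<open>X - Y\<close> turns the inequality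
    on the subspace into an equality.\<close>
  have eq: "A \<bullet> Y = L \<bullet> Y" if "Y \<in> sym_tensors" for Y
    using S[OF subspace_add[OF sub X that]] S[OF subspace_diff[OF sub X that]]
    by (simp add: inner_simps)
  \<comment> \<open>The dual slack: optimality of \<open>X\<close> over \<open>C_set\<close> gives
    it a nonnegative form on unit vectors, and homogeneity does the rest.\<close>
  define W where "W = (L \<bullet> X) *\<^sub>R trace_tensor - L"
  have pos: "0 \<le> outer x \<bullet> W" for x
  proof (cases "x = 0")
    case False
    have "0 \<le> outer (x /\<^sub>R norm x) \<bullet> W"
      using C[of "outer (x /\<^sub>R norm x)"] False
      by (simp add: C_set_eq W_def inner_commute[of "outer _"] inner_diff_left trace_tensor_inner trace_Mat_outer)
    then have "0 \<le> (norm x)\<^sup>2 * (outer (x /\<^sub>R norm x) \<bullet> W)" by simp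
    also have "\<dots> = outer (norm x *\<^sub>R (x /\<^sub>R norm x)) \<bullet> W"
      by (simp only: outer_scaleR inner_scaleR_left)
    finally show ?thesis using False by simp
  qed (simp add: outer_inner)
  have "psd (Mat Y)" using Y by (simp add: feasible_R_def)
  then have "0 \<le> W \<bullet> Y" by (rule psd_Mat_inner_nonneg) (rule pos)
  then show ?thesis
    using Y eq[OF X] eq[of Y] by (simp add: W_def inner_diff_left trace_tensor_inner feasible_R_def)
qed

text \<open>If the symmetrized slack lay outside the closed cone, a separating \<open>Z\<close>,
  scaled to trace 1, would be feasible for (R) with a value above that of \<open>X\<close>.\<close>

lemma R_optimal_imp_dual_certificate:
  fixes A X :: "('m::finite, 'n::finite) tensor"
  assumes opt: "\<And>Y. Y \<in> feasible_R \<Longrightarrow> A \<bullet> Y \<le> A \<bullet> X"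
  obtains W where "symz W = symz ((A \<bullet> X) *\<^sub>R trace_tensor - A)" "\<And>x. 0 \<le> outer x \<bullet> W"
proof -
  define G where "G = (A \<bullet> X) *\<^sub>R trace_tensor - A"
  have "symz G \<in> conic hull sos_base"
  proof (rule ccontr)
    assume "symz G \<notin> conic hull sos_base"
    then obtain Z where Z: "Z \<in> sym_tensors" "psd (Mat Z)" "Z \<bullet> G < 0"
      using separation_sos_cone by blast
    let ?t = "trace (Mat Z)"
    \<comment> \<open>A positive semidefinite matrix of trace 0 vanishes, whereas \<open>Z\<close>
      pairs strictly negatively with \<open>G\<close>.\<close>
    have "?t \<noteq> 0"
    proof
      assume "?t = 0"
      then have "Mat Z = 0" by (rule psd_trace_0[OF Z(2)])
      then have "Z = 0" unfolding tensor_eq_iff by (metis Mat_nth zero_index)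
      with Z(3) show False by simp
    qed
    moreover have "0 \<le> ?t"
      unfolding trace_def by (intro sum_nonneg psd_diag_nonneg Z(2))
    ultimately have t: "0 < ?t" by simp
    have M: "Mat (Z /\<^sub>R ?t) = Mat Z /\<^sub>R ?t" by (simp add: vec_eq_iff)
    have "Z /\<^sub>R ?t \<in> sym_tensors"
      using Z(1) by (simp add: sym_tensors_eq_perm_inv subspace_scale[OF subspace_perm_inv])
    moreover from this have "psd (Mat (Z /\<^sub>R ?t))"
      using Z(2) t by (intro psd_Mat_symI) (simp_all add: outer_inner psd_def M scaleR_matrix_vector_assoc[symmetric])
    moreover have "trace (Mat (Z /\<^sub>R ?t)) = 1"
      using t by (simp add: trace_tensor_inner[symmetric])
    ultimately have "A \<bullet> (Z /\<^sub>R ?t) \<le> A \<bullet> X"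
      by (intro opt) (simp add: feasible_R_def)
    then have "A \<bullet> Z \<le> (A \<bullet> X) * ?t"
      using t by (simp add: field_simps)
    with Z(3) show False
      by (simp add: G_def inner_diff_right inner_commute[of Z] trace_tensor_inner)
  qed
  then obtain c h where c: "0 \<le> c" "h \<in> sos_base" "symz G = c *\<^sub>R h"
    by (auto simp: conic_hull_explicit)
  obtain W where W: "symz W = h" "\<And>x. 0 \<le> outer x \<bullet> W"
    using sos_base_symz[OF c(2)] by blast
  show ?thesis
  proof (rule that)
    show "symz (c *\<^sub>R W) = symz ((A \<bullet> X) *\<^sub>R trace_tensor - A)"
      using c(3) W(1) by (simp only: linear_scale[OF linear_symz] G_def)
    show "0 \<le> outer x \<bullet> (c *\<^sub>R W)" for x
      using c(1) W(2) by simp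
  qed
qed

theorem proposition3p1:
  fixes A :: "('m::finite, 'n::finite) tensor"
  assumes "A \<in> sym_tensors"
  shows "(\<exists>Xs \<in> C_set. \<exists>Ys \<in> sym_tensors. \<exists>L :: ('m, 'n) tensor.
            (\<forall>X \<in> C_set. (- L) \<bullet> (X - Xs) \<ge> 0) \<and>
            (\<forall>Y \<in> sym_tensors. (- A + L) \<bullet> (Y - Ys) \<ge> 0) \<and>
            Xs = Ys)
         \<longleftrightarrow> tight A"
    (is "?E \<longleftrightarrow> _")
proof
  assume ?E
  then obtain X L where X: "X \<in> C_set" "X \<in> sym_tensors"
    and C: "\<And>Y. Y \<in> C_set \<Longrightarrow> 0 \<le> (- L) \<bullet> (Y - X)"
    and S: "\<And>Y. Y \<in> sym_tensors \<Longrightarrow> 0 \<le> (- A + L) \<bullet> (Y - X)"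
    by blast
  have "L \<bullet> Y \<le> L \<bullet> X" if "Y \<in> C_set" for Y
    using C[OF that] by (simp add: inner_diff_right)
  then have "\<forall>Y\<in>feasible_R. A \<bullet> Y \<le> A \<bullet> X"
    using equilibrium_imp_R_optimal[OF X(2) _ S] by blast
  with X show "tight A" by (auto simp: tight_iff feasible_O_eq)
next
  assume "tight A"
  then obtain X where X: "X \<in> C_set" "X \<in> sym_tensors"
    and opt: "\<And>Y. Y \<in> feasible_R \<Longrightarrow> A \<bullet> Y \<le> A \<bullet> X"
    by (auto simp: tight_iff feasible_O_eq)
  define v where "v = A \<bullet> X"
  obtain W where W: "symz W = symz (v *\<^sub>R trace_tensor - A)" "\<And>x. 0 \<le> outer x \<bullet> W"
    using R_optimal_imp_dual_certificate[of A X] opt unfolding v_def by blast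
  \<comment> \<open>This makes \<open>W\<close> the dual slack of \<open>L\<close>. As
    \<open>W\<close> and \<open>v *\<^sub>R trace_tensor - A\<close> have the same symmetrization,
    \<open>L\<close> and \<open>A\<close> agree on symmetric tensors.\<close>
  define L where "L = v *\<^sub>R trace_tensor - W"
  have eq: "L \<bullet> Y = A \<bullet> Y" if "Y \<in> sym_tensors" for Y
  proof -
    have "W \<bullet> Y = (v *\<^sub>R trace_tensor - A) \<bullet> Y"
      using symz_inner[of Y] that W(1) by (metis sym_tensors_eq_perm_inv)
    then show ?thesis by (simp add: L_def inner_diff_left)
  qed
  have "0 \<le> (- L) \<bullet> (Y - X)" if Y: "Y \<in> C_set" for Y
  proof -
    obtain x where x: "Y = outer x" "norm x = 1" using Y by (auto simp: C_set_eq)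
    \<comment> \<open>On unit vectors the trace term equals \<open>v\<close>, which is also the
      value of \<open>L\<close> at \<open>X\<close>.\<close>
    have "L \<bullet> Y \<le> v"
      using W(2)[of x] x by (simp add: L_def inner_diff_left trace_tensor_inner trace_Mat_outer inner_commute[of "outer _" W])
    then show ?thesis using eq[OF X(2)] by (simp add: v_def inner_diff_right)
  qed
  moreover have "0 \<le> (- A + L) \<bullet> (Y - X)" if "Y \<in> sym_tensors" for Y
    using eq[OF that] eq[OF X(2)] by (simp add: inner_simps)
  ultimately show ?E using X by blast
qed

end
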